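(* Let $d_1,\dots,d_N\in\mathbb{R}^p$ and let $\mathcal{T}\subset\mathbb{R}^p$ be a nonempty finite set. For any fixed $s\in\mathcal{T}$, the set function $g_s(S):=\max_{i\in S_0}\langle d_i,s\rangle$, $S\subseteq[N]$, is monotone and submodular. Consequently the set function $$F(S;\mathcal{T}):=\frac{1}{|\mathcal{T}|}\sum_{s\in\mathcal{T}}\max_{i\in S_0}\langle d_i,s\rangle,\qquad S\subseteq[N],$$ is monotone and submodular.
   Context: $[N]=\{1,\dots,N\}$, $d_0:=0\in\mathbb{R}^p$ and $S_0:=S\cup\{0\}$ for $S\subseteq[N]$. A set function $g:2^{[N]}\to\mathbb{R}$ is monotone if $A\subseteq C$ implies $g(A)\le g(C)$, and submodular if for all $A\subseteq C\subseteq[N]$ and $j\in[N]\setminus C$, $g(A\cup\{j\})-g(A)\ge g(C\cup\{j\})-g(C)$. *)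

theory Defs
  imports "HOL-Analysis.Analysis"
begin

definition submodular_on :: "'a set \<Rightarrow> ('a set \<Rightarrow> real) \<Rightarrow> bool" where
  "submodular_on V g \<longleftrightarrow>
     (\<forall>A C j. A \<subseteq> C \<longrightarrow> C \<subseteq> V \<longrightarrow> j \<in> V - C \<longrightarrow>
        g (A \<union> {j}) - g A \<ge> g (C \<union> {j}) - g C)"

text \<open>
  The vectors $d_1,\dots,d_N$ are the values of \<open>d\<close> on \<open>{1..N}\<close>; the value \<open>d 0\<close> is
  overridden here by the convention $d_0 := 0$.
\<close>

definition with_zero :: "(nat \<Rightarrow> real ^ 'p) \<Rightarrow> nat \<Rightarrow> real ^ 'p" where
  "with_zero d = d(0 := 0)"

definition support_value :: "(nat \<Rightarrow> real ^ 'p) \<Rightarrow> real ^ 'p \<Rightarrow> nat set \<Rightarrow> real" where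
  "support_value d s S = (MAX i \<in> S \<union> {0}. with_zero d i \<bullet> s)"

definition mean_support_value :: "(nat \<Rightarrow> real ^ 'p) \<Rightarrow> (real ^ 'p) set \<Rightarrow> nat set \<Rightarrow> real" where
  "mean_support_value d T S = 1 / real (card T) * (\<Sum>s\<in>T. MAX i \<in> S \<union> {0}. with_zero d i \<bullet> s)"

end

theory Submission
  imports Defs
begin

text \<open>Enlarging \<open>S\<close> enlarges the set over which the maximum is taken, hence
  monotonicity. Adding \<open>j\<close> turns the current value x into max(c, x), where c is
  \<open>with_zero d j \<bullet> s\<close> (\<open>support_value_insert\<close>). The gain max(c -
  x, 0) is nonincreasing in x, and x grows with \<open>S\<close>, so gains shrink: this is
  submodularity. Both properties survive linear combinations with nonnegative coefficients, hence
  pass to the average over \<open>T\<close>.\<close>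

lemma support_value_mono:
  assumes "A \<subseteq> B" and "finite B"
  shows "support_value d s A \<le> support_value d s B"
  unfolding support_value_def
  by (rule Max_mono) (use assms in auto)

text \<open>Index 0 keeps the set of inner products nonempty even for empty \<open>A\<close>, so
  \<open>Max\<close> splits off the new element.\<close>

lemma support_value_insert:
  assumes "finite A"
  shows "support_value d s (insert j A) = max (with_zero d j \<bullet> s) (support_value d s A)"
proof -
  let ?M = "(\<lambda>i. with_zero d i \<bullet> s) ` (A \<union> {0})"
  have "Max (insert (with_zero d j \<bullet> s) ?M) = max (with_zero d j \<bullet> s) (Max ?M)"
    by (rule Max_insert) (use assms in auto)
  then show ?thesis
    by (simp only: support_value_def image_insert Un_insert_left)
qed

lemma mono_on_support_value: "finite V \<Longrightarrow> mono_on (Pow V) (support_value d s)"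
  by (auto intro!: mono_onI support_value_mono intro: finite_subset)

text \<open>The increment \<open>max c x - x\<close> obtained by adding an element is decreasing in the current value \<open>x\<close>.\<close>
lemma submodular_on_support_value:
  assumes "finite V"
  shows "submodular_on V (support_value d s)"
  unfolding submodular_on_def
proof (intro allI impI)
  fix A C j
  assume "A \<subseteq> C" and "C \<subseteq> V"
  then have "finite A" "finite C"
    using assms by (meson finite_subset)+
  moreover have "support_value d s A \<le> support_value d s C"
    using \<open>A \<subseteq> C\<close> \<open>finite C\<close> by (rule support_value_mono)
  ultimately show "support_value d s (A \<union> {j}) - support_value d s A
      \<ge> support_value d s (C \<union> {j}) - support_value d s C"
    \<comment> \<open>With values a \<le> b at \<open>A\<close> and \<open>C\<close>, this is max(c,
      a) - a \<ge> max(c, b) - b; unfolding \<open>max\<close> leaves linear cases.\<close>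
    by (simp add: support_value_insert max_def)
qed

lemma mono_on_scaled_sum:
  fixes f :: "'b \<Rightarrow> 'a::order \<Rightarrow> real"
  assumes "0 \<le> c" and "\<And>s. s \<in> T \<Longrightarrow> mono_on V (f s)"
  shows "mono_on V (\<lambda>x. c * (\<Sum>s\<in>T. f s x))"
  using assms by (auto intro!: mono_onI mult_left_mono sum_mono dest: mono_onD)

text \<open>The increment of a scaled sum is the scaled sum of the increments, so the inequality can
  be checked termwise.\<close>

lemma submodular_on_scaled_sum:
  assumes "0 \<le> c" and "\<And>s. s \<in> T \<Longrightarrow> submodular_on V (f s)"
  shows "submodular_on V (\<lambda>S. c * (\<Sum>s\<in>T. f s S))"
  unfolding submodular_on_def
proof (intro allI impI)
  fix A C j
  assume "A \<subseteq> C" "C \<subseteq> V" "j \<in> V - C"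
  then have "(\<Sum>s\<in>T. f s (C \<union> {j}) - f s C) \<le> (\<Sum>s\<in>T. f s (A \<union> {j}) - f s A)"
    using assms(2) unfolding submodular_on_def by (intro sum_mono) blast
  from mult_left_mono[OF this \<open>0 \<le> c\<close>]
  show "c * (\<Sum>s\<in>T. f s (A \<union> {j})) - c * (\<Sum>s\<in>T. f s A)
      \<ge> c * (\<Sum>s\<in>T. f s (C \<union> {j})) - c * (\<Sum>s\<in>T. f s C)"
    by (simp add: sum_subtractf right_diff_distrib)
qed

lemma mean_support_value_eq:
  "mean_support_value d T = (\<lambda>S. 1 / real (card T) * (\<Sum>s\<in>T. support_value d s S))"
  by (simp add: fun_eq_iff mean_support_value_def support_value_def)

theorem proposition4p1:
  fixes N :: nat
    and d :: "nat \<Rightarrow> real ^ 'p"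
    and T :: "(real ^ 'p) set"
  assumes "finite T" and "T \<noteq> {}"
  shows "(\<forall>s\<in>T. mono_on (Pow {1..N}) (support_value d s)
                \<and> submodular_on {1..N} (support_value d s))
       \<and> mono_on (Pow {1..N}) (mean_support_value d T)
       \<and> submodular_on {1..N} (mean_support_value d T)"
  unfolding mean_support_value_eq
  \<comment> \<open>What remains is finiteness of \<open>{1..N}\<close> and nonnegativity of the
    factor \<open>1 / real (card T)\<close>.\<close>
  by (intro conjI ballI mono_on_scaled_sum submodular_on_scaled_sum
      mono_on_support_value submodular_on_support_value) simp_all

end
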